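(* Let $E$ be a nonzero real Banach space, $S\colon E\rightrightarrows E^*$ be closed, monotone and quasidense, and $(z^*,z^{**})\in E^*\times E^{**}$. Then the following are equivalent: (a) $(z^*,z^{**})\in G(S^{\mathbb F})$; (b) $\varphi_S^{**}(z^{**},\widehat{z^*})=\langle z^*,z^{**}\rangle$; (c) for all $w^*\in E^*$ there exists a sequence $\{(s_n,s_n^* )\}_{n\ge1}$ in $G(S)$ with $\langle s_n,s_n^*-w^*\rangle\to\langle z^*-w^*,z^{**}\rangle$ and $\|s_n^*-z^*\|\to0$; (d) for all $(w,w^* )\in E\times E^*$ there exists a sequence $\{(s_n,s_n^* )\}_{n\ge1}$ in $G(S)$ with $\langle s_n-w,s_n^*-w^*\rangle\to\langle z^*-w^*,z^{**}-\widehat w\rangle$ and $\|s_n^*-z^*\|\to0$.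
   Context: $\widehat w\in E^{**}$, $\widehat{z^*}\in E^{***}$ are canonical images. For a multifunction $S\colon E\rightrightarrows E^*$ with nonempty graph: closed means $G(S)$ norm-closed; monotone means $\langle s-t,s^*-t^*\rangle\ge0$ on $G(S)$; quasidense means for every $(x,x^* )$, $\inf_{(s,s^* )\in G(S)}[\tfrac12\|s-x\|^2+\tfrac12\|s^*-x^*\|^2+\langle s-x,s^*-x^*\rangle]\le0$. $\varphi_S(x,x^* )=\sup_{(s,s^* )\in G(S)}[\langle s,x^*\rangle+\langle x,s^*\rangle-\langle s,s^*\rangle]$; $\varphi_S^*$ is its conjugate on $E^*\times E^{**}$ under $\langle (x,x^* ),(y^*,y^{**})\rangle=\langle x,y^*\rangle+\langle x^*,y^{**}\rangle$, and $\varphi_S^{**}$ is the conjugate of $\varphi_S^*$ on $E^{**}\times E^{***}$ under $\langle (y^*,y^{**}),(x^{**},x^{***})\rangle=\langle y^*,x^{**}\rangle+\langle y^{**},x^{***}\rangle$. The Fitzpatrick extension $S^{\mathbb F}\colon E^*\rightrightarrows E^{**}$ is given by $(y^*,y^{**})\in G(S^{\mathbb F})$ iff $\varphi_S^*(y^*,y^{**})=\langle y^*,y^{**}\rangle$. *)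

theory Defs
  imports "HOL-Analysis.Analysis" "HOL-Library.Extended_Real"
begin

(* Dual space of E is the type E =>L real; the duality pairing
  <x, x*> is blinfun_apply x* x.  A multifunction S : E =>> E* is given by its
  graph G subset of E x E*. *)

definition canon :: "'b::real_normed_vector \<Rightarrow> ('b \<Rightarrow>\<^sub>L real) \<Rightarrow>\<^sub>L real" where
  "canon w = Blinfun (\<lambda>f. blinfun_apply f w)"

definition monotone_graph :: "('a::real_normed_vector \<times> ('a \<Rightarrow>\<^sub>L real)) set \<Rightarrow> bool" where
  "monotone_graph G \<longleftrightarrow>
     (\<forall>(s, s') \<in> G. \<forall>(t, t') \<in> G. blinfun_apply (s' - t') (s - t) \<ge> 0)"

definition quasidense :: "('a::real_normed_vector \<times> ('a \<Rightarrow>\<^sub>L real)) set \<Rightarrow> bool" where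
  "quasidense G \<longleftrightarrow>
     (\<forall>x x'. (INF (s, s') \<in> G. ereal ((norm (s - x))\<^sup>2 / 2 + (norm (s' - x'))\<^sup>2 / 2
                + blinfun_apply (s' - x') (s - x))) \<le> 0)"

definition phi :: "('a::real_normed_vector \<times> ('a \<Rightarrow>\<^sub>L real)) set \<Rightarrow> 'a \<Rightarrow> ('a \<Rightarrow>\<^sub>L real) \<Rightarrow> ereal" where
  "phi G x x' = (SUP (s, s') \<in> G. ereal (blinfun_apply x' s + blinfun_apply s' x - blinfun_apply s' s))"

definition phi_star :: "('a::real_normed_vector \<times> ('a \<Rightarrow>\<^sub>L real)) set
     \<Rightarrow> ('a \<Rightarrow>\<^sub>L real) \<Rightarrow> (('a \<Rightarrow>\<^sub>L real) \<Rightarrow>\<^sub>L real) \<Rightarrow> ereal" where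
  "phi_star G y' y'' = (SUP (x, x') \<in> UNIV.
      ereal (blinfun_apply y' x + blinfun_apply y'' x') - phi G x x')"

definition phi_star_star :: "('a::real_normed_vector \<times> ('a \<Rightarrow>\<^sub>L real)) set
     \<Rightarrow> (('a \<Rightarrow>\<^sub>L real) \<Rightarrow>\<^sub>L real) \<Rightarrow> ((('a \<Rightarrow>\<^sub>L real) \<Rightarrow>\<^sub>L real) \<Rightarrow>\<^sub>L real) \<Rightarrow> ereal" where
  "phi_star_star G x'' x''' = (SUP (y', y'') \<in> UNIV.
      ereal (blinfun_apply x'' y' + blinfun_apply x''' y'') - phi_star G y' y'')"

definition fitz_ext :: "('a::real_normed_vector \<times> ('a \<Rightarrow>\<^sub>L real)) set
     \<Rightarrow> (('a \<Rightarrow>\<^sub>L real) \<times> (('a \<Rightarrow>\<^sub>L real) \<Rightarrow>\<^sub>L real)) set" where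
  "fitz_ext G = {(y', y''). phi_star G y' y'' = ereal (blinfun_apply y'' y')}"

end

theory Submission
  imports Defs
begin

text \<open>
  Quasidensity at points \<open>(0, y' + u)\<close>, with \<open>u\<close> nearly norming \<open>y''\<close>, shows that \<open>phi_star\<close>
  dominates the duality pairing. A convex function that dominates the pairing and touches it at
  \<open>(z', z'')\<close> has the derivative of the pairing there as a subgradient, which is (b).

  Conversely, (b) says that \<open>(z'', z')\<close> cannot be strictly separated from the epigraph of
  \<open>phi\<close>. By Hahn-Banach and Helly's theorem there are then points \<open>(x, x')\<close> with \<open>x\<close>
  bounded, \<open>x'\<close> close to \<open>z'\<close>, \<open>(z' - w') x\<close> close to \<open>z'' (z' - w')\<close>, and
  \<open>phi G x x'\<close> only slightly above \<open>x' x\<close>. Quasidensity at such a point yields an element of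
  the graph close to it in norm, which is (c).
\<close>

subsection \<open>Hahn-Banach separation and Helly's theorem\<close>

definition sublinear :: "('a::real_vector \<Rightarrow> real) \<Rightarrow> bool" where
  "sublinear p \<longleftrightarrow> (\<forall>x y. p (x + y) \<le> p x + p y) \<and> (\<forall>c x. 0 \<le> c \<longrightarrow> p (c *\<^sub>R x) = c * p x)"

lemma sublinear_add: "sublinear p \<Longrightarrow> p (x + y) \<le> p x + p y"
  and sublinear_scale: "sublinear p \<Longrightarrow> 0 \<le> c \<Longrightarrow> p (c *\<^sub>R x) = c * p x"
  by (auto simp: sublinear_def)

lemma sublinear_zero: "sublinear p \<Longrightarrow> p 0 = 0"
  using sublinear_scale[of p 0 0] by simp

lemma sublinear_neg_ge: "sublinear p \<Longrightarrow> - p (- x) \<le> p x"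
  using sublinear_add[of p x "- x"] by (simp add: sublinear_zero)

text \<open>The inequality for \<open>c > 0\<close>, applied to \<open>inverse c\<close> and
  \<open>c *\<^sub>R x\<close>, gives the reverse inequality, so homogeneity needs only one
  direction.\<close>

lemma sublinearI:
  assumes "\<And>x y. p (x + y) \<le> p x + p y"
    and "\<And>c x. 0 < c \<Longrightarrow> p (c *\<^sub>R x) \<le> c * p x" and "p 0 = 0"
  shows "sublinear p"
proof -
  have "p (c *\<^sub>R x) = c * p x" if c: "0 \<le> c" for c x
  proof (cases "c = 0")
    case False
    then have "c > 0" using c by simp
    have "p (inverse c *\<^sub>R (c *\<^sub>R x)) \<le> inverse c * p (c *\<^sub>R x)"
      using \<open>c > 0\<close> by (intro assms(2)) simp
    then have "c * p x \<le> p (c *\<^sub>R x)"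
      using \<open>c > 0\<close> by (simp add: field_simps)
    with assms(2)[OF \<open>c > 0\<close>, of x] show ?thesis by simp
  qed (simp add: assms(3))
  with assms(1) show ?thesis by (auto simp: sublinear_def)
qed

text \<open>\<open>Q\<close> lowers \<open>q\<close> along the ray spanned by \<open>y\<close>. If
  \<open>q\<close> is minimal then \<open>Q = q\<close>, and the last bound becomes
  \<open>q x + q y \<le> q (x + y)\<close>. Subadditivity bounds every term of the infimum below by
  \<open>- q (- x)\<close>.\<close>

lemma sublinear_INF_ray:
  fixes q :: "'a::real_vector \<Rightarrow> real" and y :: 'a
  assumes q: "sublinear q"
  defines "Q \<equiv> \<lambda>x. INF t\<in>{0..}. q (x + t *\<^sub>R y) - t * q y"
  shows "sublinear Q" and "Q x \<le> q x" and "Q x \<le> q (x + y) - q y"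
proof -
  have low: "- q (- x) \<le> q (x + t *\<^sub>R y) - t * q y" if "0 \<le> t" for x t
    using sublinear_add[OF q, of "x + t *\<^sub>R y" "- x"] that
    by (simp add: sublinear_scale[OF q])
  then have bdd: "bdd_below ((\<lambda>t. q (x + t *\<^sub>R y) - t * q y) ` {0..})" for x
    by (intro bdd_belowI2[where m = "- q (- x)"]) auto
  have le: "Q x \<le> q (x + t *\<^sub>R y) - t * q y" if "0 \<le> t" for x t
    unfolding Q_def using that by (intro cINF_lower bdd) auto
  have ge: "m \<le> Q x" if "\<And>t. 0 \<le> t \<Longrightarrow> m \<le> q (x + t *\<^sub>R y) - t * q y" for m x
    unfolding Q_def using that by (intro cINF_greatest) auto
  show "Q x \<le> q x" using le[of 0 x] by simp
  show "Q x \<le> q (x + y) - q y" using le[of 1 x] by simp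
  show "sublinear Q"
  proof (rule sublinearI)
    fix u v
    \<comment> \<open>The terms with parameters \<open>t\<close> for \<open>u\<close> and
      \<open>r\<close> for \<open>v\<close> together dominate the term with parameter
      \<open>t + r\<close> for \<open>u + v\<close>.\<close>
    have "Q (u + v) - (q (u + t *\<^sub>R y) - t * q y) \<le> q (v + r *\<^sub>R y) - r * q y"
      if "0 \<le> t" "0 \<le> r" for t r
      using le[of "t + r" "u + v"] that
        sublinear_add[OF q, of "u + t *\<^sub>R y" "v + r *\<^sub>R y"]
      by (simp add: algebra_simps)
    then have "Q (u + v) - (q (u + t *\<^sub>R y) - t * q y) \<le> Q v" if "0 \<le> t" for t
      using that by (intro ge)
    then have "Q (u + v) - Q v \<le> Q u"
      by (intro ge) (smt (verit))
    then show "Q (u + v) \<le> Q u + Q v" by simp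
  next
    fix c :: real and u assume c: "0 < c"
    have "Q (c *\<^sub>R u) / c \<le> q (u + t *\<^sub>R y) - t * q y" if "0 \<le> t" for t
    proof -
      have "Q (c *\<^sub>R u) \<le> q (c *\<^sub>R u + (c * t) *\<^sub>R y) - (c * t) * q y"
        using c that by (intro le) simp
      also have "q (c *\<^sub>R u + (c * t) *\<^sub>R y) = c * q (u + t *\<^sub>R y)"
        using c sublinear_scale[OF q, of c "u + t *\<^sub>R y"] by (simp add: scaleR_add_right)
      finally show ?thesis using c by (simp add: field_simps)
    qed
    then have "Q (c *\<^sub>R u) / c \<le> Q u" by (rule ge)
    then show "Q (c *\<^sub>R u) \<le> c * Q u" using c by (simp add: field_simps)
  next
    have "0 \<le> Q 0" by (rule ge) (simp add: sublinear_scale[OF q])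
    moreover have "Q 0 \<le> 0" using le[of 0 0] by (simp add: sublinear_zero[OF q])
    ultimately show "Q 0 = 0" by simp
  qed
qed

text \<open>This supplies the bound of a chain for Zorn's lemma. Subadditivity survives the infimum
  because, of two members of the chain, the smaller one can be used at both points; the common
  majorant \<open>p\<close> keeps the infimum finite.\<close>

lemma sublinear_INF_chain:
  fixes C :: "('a::real_vector \<Rightarrow> real) set"
  assumes ne: "C \<noteq> {}" and sub: "\<And>q. q \<in> C \<Longrightarrow> sublinear q"
    and le_p: "\<And>q x. q \<in> C \<Longrightarrow> q x \<le> p x"
    and chain: "\<And>q r. q \<in> C \<Longrightarrow> r \<in> C \<Longrightarrow> (\<forall>x. q x \<le> r x) \<or> (\<forall>x. r x \<le> q x)"
  defines "Q \<equiv> \<lambda>x. INF q\<in>C. q x"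
  shows "sublinear Q" and "q \<in> C \<Longrightarrow> Q x \<le> q x"
proof -
  have "- p (- x) \<le> q x" if "q \<in> C" for q x
    using sublinear_neg_ge[OF sub[OF that], of x] le_p[OF that, of "- x"] by linarith
  then have bdd: "bdd_below ((\<lambda>q. q x) ` C)" for x
    by (intro bdd_belowI2[where m = "- p (- x)"]) auto
  have le: "Q x \<le> q x" if "q \<in> C" for q x
    unfolding Q_def using that by (intro cINF_lower bdd)
  then show "q \<in> C \<Longrightarrow> Q x \<le> q x" .
  have ge: "m \<le> Q x" if "\<And>q. q \<in> C \<Longrightarrow> m \<le> q x" for m x
    unfolding Q_def using that ne by (intro cINF_greatest) auto
  show "sublinear Q"
  proof (rule sublinearI)
    fix u v
    have "Q (u + v) - q u \<le> r v" if qr: "q \<in> C" "r \<in> C" for q r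
      using chain[OF qr]
    proof
      assume "\<forall>x. q x \<le> r x"
      then show ?thesis
        using le[OF qr(1), of "u + v"] sublinear_add[OF sub[OF qr(1)], of u v]
        by (smt (verit))
    next
      assume "\<forall>x. r x \<le> q x"
      then show ?thesis
        using le[OF qr(2), of "u + v"] sublinear_add[OF sub[OF qr(2)], of u v]
        by (smt (verit))
    qed
    then have "Q (u + v) - q u \<le> Q v" if "q \<in> C" for q
      using that by (intro ge)
    then have "Q (u + v) - Q v \<le> Q u"
      by (intro ge) (smt (verit))
    then show "Q (u + v) \<le> Q u + Q v" by simp
  next
    fix c :: real and u assume c: "0 < c"
    have "Q (c *\<^sub>R u) / c \<le> q u" if "q \<in> C" for q
      using le[OF that, of "c *\<^sub>R u"] c
      by (simp add: sublinear_scale[OF sub[OF that]] field_simps)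
    then have "Q (c *\<^sub>R u) / c \<le> Q u" by (rule ge)
    then show "Q (c *\<^sub>R u) \<le> c * Q u" using c by (simp add: field_simps)
  next
    show "Q 0 = 0" unfolding Q_def using ne by (simp add: sublinear_zero sub)
  qed
qed

text \<open>
  A minimal sublinear function below \<open>p\<close> is linear, because it cannot be lowered along any ray.
\<close>

theorem sublinear_dominates_linear:
  fixes p :: "'a::real_vector \<Rightarrow> real"
  assumes p: "sublinear p"
  obtains f where "linear f" and "\<And>x. f x \<le> p x"
proof -
  define A where "A = {q. sublinear q \<and> (\<forall>x. q x \<le> p x)}"
  \<comment> \<open>The pointwise order is reversed, so that a maximal element for \<open>P\<close>
    is a minimal sublinear function.\<close>
  define P :: "('a \<Rightarrow> real) \<Rightarrow> ('a \<Rightarrow> real) \<Rightarrow> bool" where "P = (\<lambda>q r. \<forall>x. r x \<le> q x)"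
  have "\<exists>m\<in>A. \<forall>q\<in>A. P m q \<longrightarrow> q = m"
  proof (rule predicate_Zorn)
    show "partial_order_on A (relation_of P A)"
      by (rule partial_order_on_relation_ofI) (auto simp: P_def fun_eq_iff intro: order_trans antisym)
  next
    fix C assume C: "C \<in> Chains (relation_of P A)"
    show "\<exists>u\<in>A. \<forall>q\<in>C. P q u"
    proof (cases "C = {}")
      case True
      then show ?thesis using p by (auto simp: A_def)
    next
      case False
      have CA: "q \<in> A" if "q \<in> C" for q
        using C that by (auto simp: Chains_def relation_of_def)
      have ch: "(\<forall>x. q x \<le> r x) \<or> (\<forall>x. r x \<le> q x)" if "q \<in> C" "r \<in> C" for q r
        using C that by (auto simp: Chains_def relation_of_def P_def)
      note Q = sublinear_INF_chain[of C p, OF False _ _ ch]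
      have Q1: "sublinear (\<lambda>x. INF q\<in>C. q x)" and Q2: "\<And>q x. q \<in> C \<Longrightarrow> (INF q\<in>C. q x) \<le> q x"
        using CA by (auto intro!: Q simp: A_def)
      obtain q0 where "q0 \<in> C" using False by auto
      then have "(INF q\<in>C. q x) \<le> p x" for x
        using Q2[of q0 x] CA[of q0] by (auto simp: A_def intro: order_trans)
      with Q1 Q2 show ?thesis
        by (intro bexI[where x = "\<lambda>x. INF q\<in>C. q x"]) (auto simp: A_def P_def)
    qed
  qed
  then obtain q where "q \<in> A" and min: "\<And>r. r \<in> A \<Longrightarrow> P q r \<Longrightarrow> r = q" by blast
  then have q: "sublinear q" and qp: "\<And>x. q x \<le> p x" by (auto simp: A_def)
  have add: "q (x + y) = q x + q y" for x y
  proof -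
    define Q where "Q = (\<lambda>x. INF t\<in>{0..}. q (x + t *\<^sub>R y) - t * q y)"
    have Q: "sublinear Q" "\<And>x. Q x \<le> q x" "\<And>x. Q x \<le> q (x + y) - q y"
      unfolding Q_def by (rule sublinear_INF_ray[OF q])+
    have "Q x \<le> p x" for x using Q(2) qp by (rule order_trans)
    with Q have "Q = q" by (intro min) (simp_all add: A_def P_def)
    with Q(3) have "q x \<le> q (x + y) - q y" by simp
    with sublinear_add[OF q, of x y] show ?thesis by simp
  qed
  have neg: "q (- x) = - q x" for x
    using add[of x "- x"] by (simp add: sublinear_zero[OF q])
  have "q (c *\<^sub>R x) = c * q x" for c x
  proof (cases "0 \<le> c")
    case False
    then have "q ((- c) *\<^sub>R x) = (- c) * q x" by (intro sublinear_scale[OF q]) simp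
    then show ?thesis using neg[of "c *\<^sub>R x"] by simp
  qed (simp add: sublinear_scale[OF q])
  with add have "linear q" by (intro linearI) auto
  with qp show thesis by (rule that[rotated])
qed

text \<open>A linear function below the sublinear \<open>Q\<close> is at most the norm (take
  \<open>t = 0\<close>) and at most \<open>- r\<close> at \<open>- d\<close> (take
  \<open>t = 1\<close>), hence at least \<open>r\<close> on \<open>D\<close>. The bound
  \<open>r \<le> norm d\<close> keeps the infimum finite.\<close>

theorem convex_norm_ge_separation:
  fixes D :: "'a::real_normed_vector set"
  assumes "convex D" and "D \<noteq> {}" and ge: "\<And>d. d \<in> D \<Longrightarrow> r \<le> norm d"
  obtains L :: "'a \<Rightarrow>\<^sub>L real" where "\<And>d. d \<in> D \<Longrightarrow> r \<le> L d"
proof -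
  define I where "I = {0::real..} \<times> D"
  define Q where "Q = (\<lambda>v. INF (t, d)\<in>I. norm (v + t *\<^sub>R d) - t * r)"
  have low: "- norm v \<le> norm (v + t *\<^sub>R d) - t * r" if "0 \<le> t" "d \<in> D" for v t d
  proof -
    have "t * r \<le> norm (t *\<^sub>R d)" using that ge[of d] by (simp add: mult_left_mono)
    moreover have "norm (t *\<^sub>R d) \<le> norm (v + t *\<^sub>R d) + norm v"
      using norm_triangle_ineq4[of "v + t *\<^sub>R d" v] by simp
    ultimately show ?thesis by simp
  qed
  then have bdd: "bdd_below ((\<lambda>(t, d). norm (v + t *\<^sub>R d) - t * r) ` I)" for v
    by (intro bdd_belowI2[where m = "- norm v"]) (auto simp: I_def)
  have le: "Q v \<le> norm (v + t *\<^sub>R d) - t * r" if "0 \<le> t" "d \<in> D" for v t d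
    using cINF_lower[OF bdd, of "(t, d)" v] that by (auto simp: Q_def I_def)
  have geQ: "m \<le> Q v" if "\<And>t d. 0 \<le> t \<Longrightarrow> d \<in> D \<Longrightarrow> m \<le> norm (v + t *\<^sub>R d) - t * r" for m v
    unfolding Q_def using that \<open>D \<noteq> {}\<close> by (intro cINF_greatest) (auto simp: I_def)
  obtain d0 where d0: "d0 \<in> D" using \<open>D \<noteq> {}\<close> by auto
  have Q_norm: "Q v \<le> norm v" for v
    using le[OF order_refl d0, of v] by simp
  have "sublinear Q"
  proof (rule sublinearI)
    fix u v
    have "Q (u + v) - (norm (u + t *\<^sub>R d) - t * r) \<le> norm (v + s *\<^sub>R e) - s * r"
      if t: "0 \<le> t" "d \<in> D" and s: "0 \<le> s" "e \<in> D" for t d s e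
    proof (cases "t + s = 0")
      case True
      then have "t = 0" "s = 0" using t s by auto
      then show ?thesis
        using Q_norm[of "u + v"] norm_triangle_ineq[of u v] by simp
    next
      case False
      then have ts: "t + s > 0" using t s by simp
      \<comment> \<open>By convexity \<open>t *\<^sub>R d + s *\<^sub>R e\<close> is
        \<open>t + s\<close> times a point of \<open>D\<close>, hence admissible in the infimum for
        \<open>u + v\<close>.\<close>
      define f where "f = (t / (t + s)) *\<^sub>R d + (s / (t + s)) *\<^sub>R e"
      have "f \<in> D" unfolding f_def using \<open>convex D\<close> t s ts
        by (intro convexD) (auto simp: add_divide_distrib[symmetric])
      have "(t + s) *\<^sub>R f = t *\<^sub>R d + s *\<^sub>R e"
        unfolding f_def using ts by (simp add: scaleR_add_right)
      then have "Q (u + v) \<le> norm ((u + t *\<^sub>R d) + (v + s *\<^sub>R e)) - (t + s) * r"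
        using le[OF _ \<open>f \<in> D\<close>, of "t + s" "u + v"] ts by (simp add: algebra_simps)
      then show ?thesis
        using norm_triangle_ineq[of "u + t *\<^sub>R d" "v + s *\<^sub>R e"] by (simp add: algebra_simps)
    qed
    then have "Q (u + v) - (norm (u + t *\<^sub>R d) - t * r) \<le> Q v" if "0 \<le> t" "d \<in> D" for t d
      using that by (intro geQ)
    then have "Q (u + v) - Q v \<le> Q u"
      by (intro geQ) (smt (verit))
    then show "Q (u + v) \<le> Q u + Q v" by simp
  next
    fix c :: real and u assume c: "0 < c"
    have "Q (c *\<^sub>R u) / c \<le> norm (u + t *\<^sub>R d) - t * r" if "0 \<le> t" "d \<in> D" for t d
    proof -
      have "Q (c *\<^sub>R u) \<le> norm (c *\<^sub>R u + (c * t) *\<^sub>R d) - (c * t) * r"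
        using c that by (intro le) auto
      also have "norm (c *\<^sub>R u + (c * t) *\<^sub>R d) = c * norm (u + t *\<^sub>R d)"
        using c norm_scaleR[of c "u + t *\<^sub>R d"] by (simp add: scaleR_add_right)
      finally show ?thesis using c by (simp add: field_simps)
    qed
    then have "Q (c *\<^sub>R u) / c \<le> Q u" by (rule geQ)
    then show "Q (c *\<^sub>R u) \<le> c * Q u" using c by (simp add: field_simps)
  next
    have "0 \<le> Q 0" using low[where v = 0] by (intro geQ) auto
    with Q_norm[of 0] show "Q 0 = 0" by simp
  qed
  then obtain f where f: "linear f" and fQ: "\<And>x. f x \<le> Q x"
    by (rule sublinear_dominates_linear) blast
  have f_norm: "f x \<le> norm x" for x using fQ[of x] Q_norm[of x] by linarith
  have "norm (f x) \<le> norm x * 1" for x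
    using f_norm[of x] f_norm[of "- x"] by (simp add: linear_neg[OF f] abs_le_iff)
  then have bl: "bounded_linear f"
    using f by (intro bounded_linear.intro bounded_linear_axioms.intro) blast+
  show thesis
  proof (rule that[of "Blinfun f"])
    fix d assume d: "d \<in> D"
    have "f (- d) \<le> - r" using fQ[of "- d"] le[of 1 d "- d"] d by simp
    then show "r \<le> Blinfun f d"
      by (simp add: bounded_linear_Blinfun_apply[OF bl] linear_neg[OF f])
  qed
qed

text \<open>If \<open>(z p, z y)\<close> lay outside the closed convex image of the ball in the
  plane, a separating line would give a combination \<open>g\<close> of \<open>p\<close> and
  \<open>y\<close> with \<open>z g > R * norm g\<close>, contrary to
  \<open>norm z < R\<close>.\<close>

lemma Helly_two_functionals:
  fixes p y :: "'a::real_normed_vector \<Rightarrow>\<^sub>L real" and z :: "('a \<Rightarrow>\<^sub>L real) \<Rightarrow>\<^sub>L real"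
  assumes "norm z < R" and "0 < e"
  obtains x where "norm x < R" "\<bar>p x - z p\<bar> < e" "\<bar>y x - z y\<bar> < e"
proof -
  define T where "T = (\<lambda>x. (p x, y x)) ` ball 0 R"
  have R: "0 < R" using assms(1) norm_ge_zero[of z] by linarith
  have lin: "linear (\<lambda>x. (p x, y x))"
    by (intro linearI) (auto simp: blinfun.bilinear_simps)
  have "(z p, z y) \<in> closure T"
  proof (rule ccontr)
    assume "(z p, z y) \<notin> closure T"
    moreover have "convex (closure T)"
      unfolding T_def by (intro convex_closure convex_linear_image lin convex_ball)
    ultimately obtain a b where lt: "inner a (z p, z y) < b" and gt: "\<And>t. t \<in> closure T \<Longrightarrow> b < inner a t"
      using separating_hyperplane_closed_point[of "closure T" "(z p, z y)"] by (meson closed_closure)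
    \<comment> \<open>The separating line is pulled back to the space, with the sign chosen so that
      \<open>g\<close> stays below \<open>c\<close> on the ball while \<open>z g\<close> exceeds
      \<open>c\<close>.\<close>
    define g where "g = - (fst a *\<^sub>R p + snd a *\<^sub>R y)"
    define c where "c = - b"
    have zg: "c < z g"
      using lt by (cases a) (simp add: g_def c_def blinfun.bilinear_simps)
    have gx: "g x < c" if "norm x < R" for x
    proof -
      have "(p x, y x) \<in> closure T"
        using that closure_subset[of T] by (auto simp: T_def)
      from gt[OF this] show ?thesis
        by (cases a) (simp add: g_def c_def blinfun.bilinear_simps)
    qed
    have c: "0 < c" using gx[of 0] R by (simp add: blinfun.bilinear_simps)
    have "norm g \<le> c / R"
    proof (rule norm_blinfun_bound)
      show "0 \<le> c / R" using c R by simp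
      fix x
      have le: "g x \<le> c / R * norm x" for x
      proof (rule field_le_epsilon)
        fix d :: real assume d: "0 < d"
        \<comment> \<open>The excess over \<open>norm x\<close> puts
          \<open>(R / m) *\<^sub>R x\<close> strictly inside the ball, also for
          \<open>x = 0\<close>, and costs exactly \<open>d\<close> in the final bound.\<close>
        define m where "m = norm x + d * R / c"
        have "norm x < m" using c R d by (simp add: m_def)
        then have m: "0 < m" using norm_ge_zero[of x] by linarith
        have "norm ((R / m) *\<^sub>R x) = R * (norm x / m)" using m R by simp
        also have "\<dots> < R * 1"
          using \<open>norm x < m\<close> m R by (intro mult_strict_left_mono) simp_all
        finally have "g ((R / m) *\<^sub>R x) < c" by (intro gx) simp
        then have "g x < c * m / R"
          using m R by (simp add: blinfun.scaleR_right field_simps)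
        also have "c * m / R = c / R * norm x + d"
          using c R by (simp add: m_def field_simps)
        finally show "g x \<le> c / R * norm x + d" by simp
      qed
      show "norm (g x) \<le> c / R * norm x"
        using le[of x] le[of "- x"] by (simp add: blinfun.minus_right abs_le_iff)
    qed
    then have "R * norm g \<le> c" using R by (simp add: field_simps)
    moreover have "z g \<le> norm z * norm g"
      using norm_blinfun[of z g] by simp
    moreover have "norm z * norm g \<le> R * norm g"
      using assms(1) by (intro mult_right_mono) auto
    ultimately show False using zg by linarith
  qed
  then obtain t where "t \<in> T" "dist t (z p, z y) < e"
    using \<open>0 < e\<close> unfolding closure_approachable by blast
  then obtain x where x: "norm x < R" "dist (p x, y x) (z p, z y) < e"
    by (auto simp: T_def)
  have "\<bar>p x - z p\<bar> < e" "\<bar>y x - z y\<bar> < e"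
    using x(2) dist_fst_le[of "(p x, y x)" "(z p, z y)"] dist_snd_le[of "(p x, y x)" "(z p, z y)"]
    by (auto simp: dist_real_def)
  with x(1) show thesis by (rule that)
qed

subsection \<open>The Fitzpatrick function and its conjugates\<close>

lemma canon_apply [simp]: "canon w f = f w"
  unfolding canon_def by (simp add: bounded_linear_Blinfun_apply blinfun.bounded_linear_left)

lemma phi_le_iff:
  fixes G :: "('a::real_normed_vector \<times> ('a \<Rightarrow>\<^sub>L real)) set"
  shows "phi G x x' \<le> ereal t \<longleftrightarrow> (\<forall>(s, s')\<in>G. x' s + s' x - s' s \<le> t)"
  unfolding phi_def by (auto simp: SUP_le_iff)

text \<open>Expanding \<open>0 \<le> (s' - t') (s - t)\<close> bounds each term of the supremum by
  \<open>s' s\<close>.\<close>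

lemma phi_graph_le:
  fixes G :: "('a::real_normed_vector \<times> ('a \<Rightarrow>\<^sub>L real)) set"
  assumes "monotone_graph G" and "(s, s') \<in> G"
  shows "phi G s s' \<le> ereal (s' s)"
proof -
  have "0 \<le> (s' - t') (s - t)" if "(t, t') \<in> G" for t t'
    using assms that unfolding monotone_graph_def by fast
  then show ?thesis
    unfolding phi_le_iff by (fastforce simp: blinfun.bilinear_simps)
qed

lemma phi_not_MInf:
  fixes G :: "('a::real_normed_vector \<times> ('a \<Rightarrow>\<^sub>L real)) set"
  assumes "G \<noteq> {}"
  shows "phi G x x' \<noteq> - \<infinity>"
proof -
  obtain s s' where "(s, s') \<in> G" using assms by auto
  then have "ereal (x' s + s' x - s' s) \<le> phi G x x'"
    unfolding phi_def by (intro SUP_upper2[of "(s, s')"]) auto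
  then show ?thesis by auto
qed

text \<open>Quantifying over real majorants \<open>t\<close> of \<open>phi\<close>, that is over its
  epigraph, removes the extended-real subtraction: points where \<open>phi\<close> is infinite
  impose no condition, and nonemptiness of \<open>G\<close> excludes minus infinity.\<close>

lemma phi_star_le_iff:
  fixes G :: "('a::real_normed_vector \<times> ('a \<Rightarrow>\<^sub>L real)) set"
    and y' :: "'a \<Rightarrow>\<^sub>L real" and y'' :: "('a \<Rightarrow>\<^sub>L real) \<Rightarrow>\<^sub>L real"
  assumes "G \<noteq> {}"
  shows "phi_star G y' y'' \<le> ereal c \<longleftrightarrow>
    (\<forall>x x' t. phi G x x' \<le> ereal t \<longrightarrow> y' x + y'' x' \<le> c + t)"
proof -
  have "ereal a - phi G x x' \<le> ereal c \<longleftrightarrow> (\<forall>t. phi G x x' \<le> ereal t \<longrightarrow> a \<le> c + t)" for a x x'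
  proof (cases "phi G x x'")
    case (real r)
    then have "ereal a - phi G x x' \<le> ereal c \<longleftrightarrow> a \<le> c + r" by auto
    also have "\<dots> \<longleftrightarrow> (\<forall>t. r \<le> t \<longrightarrow> a \<le> c + t)"
      by (auto intro: order_trans)
    finally show ?thesis using real by simp
  qed (use phi_not_MInf[OF assms] in auto)
  then show ?thesis
    unfolding phi_star_def by (auto simp: SUP_le_iff)
qed

section \<open>Consequences of quasidensity\<close>

lemma quasidenseD:
  fixes G :: "('a::real_normed_vector \<times> ('a \<Rightarrow>\<^sub>L real)) set"
  assumes "quasidense G" and "0 < e"
  obtains s s' where "(s, s') \<in> G"
    "(norm (s - x))\<^sup>2 / 2 + (norm (s' - x'))\<^sup>2 / 2 + (s' - x') (s - x) < e"
proof -
  define f where "f = (\<lambda>(s, s'). (norm (s - x))\<^sup>2 / 2 + (norm (s' - x'))\<^sup>2 / 2 + (s' - x') (s - x))"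
  have "(INF a\<in>G. ereal (f a)) \<le> 0"
    using assms(1)[unfolded quasidense_def, rule_format, of x x'] by (simp add: f_def case_prod_unfold)
  also have "0 < ereal e" using assms(2) by simp
  finally obtain a where "a \<in> G" "f a < e"
    unfolding INF_less_iff by auto
  then show thesis
    using that[of "fst a" "snd a"] by (simp add: f_def case_prod_unfold)
qed

text \<open>If \<open>z\<close> stayed below \<open>(norm z)\<^sup>2 - e\<close> on the ball of
  radius \<open>norm z\<close>, homogeneity would make its norm smaller than it is. The error
  \<open>e\<close> is there because the norm need not be attained.\<close>

lemma nearly_norming:
  fixes z :: "'b::real_normed_vector \<Rightarrow>\<^sub>L real"
  assumes "0 < e"
  obtains u where "norm u \<le> norm z" "(norm z)\<^sup>2 - e \<le> z u"
proof (cases "norm z = 0")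
  case True
  then show thesis using that[of 0] assms by (simp add: blinfun.bilinear_simps)
next
  case False
  define n where "n = norm z"
  have n: "0 < n" using False by (simp add: n_def)
  have "\<exists>u. norm u \<le> n \<and> n\<^sup>2 - e \<le> z u"
  proof (rule ccontr)
    assume "\<not> ?thesis"
    then have lt: "z u < n\<^sup>2 - e" if "norm u \<le> n" for u using that by force
    have ne: "0 < n\<^sup>2 - e" using lt[of 0] n by (simp add: blinfun.bilinear_simps)
    have le: "z x \<le> (n\<^sup>2 - e) / n * norm x" for x
    proof (cases "x = 0")
      case False
      have "z ((n / norm x) *\<^sub>R x) < n\<^sup>2 - e"
        using n False by (intro lt) simp
      then show ?thesis using n False by (simp add: blinfun.bilinear_simps field_simps)
    qed (simp add: blinfun.bilinear_simps)
    have "norm z \<le> (n\<^sup>2 - e) / n"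
    proof (rule norm_blinfun_bound)
      show "norm (z x) \<le> (n\<^sup>2 - e) / n * norm x" for x
        using le[of x] le[of "- x"] by (simp add: blinfun.bilinear_simps abs_le_iff)
    qed (use ne n in simp)
    then show False using n assms by (simp add: n_def[symmetric] field_simps power2_eq_square)
  qed
  then show thesis using that by (auto simp: n_def)
qed

text \<open>This is the negative infimum property. With \<open>a = s' - (y' + u)\<close> the pairing
  is \<open>a s + u s - y'' a - y'' u\<close>. The terms \<open>u s\<close> and
  \<open>- y'' a\<close> are absorbed by the half squares of \<open>norm s\<close> and
  \<open>norm a\<close> at a cost of \<open>n\<^sup>2 / 2\<close> each, which
  \<open>y'' u \<ge> n\<^sup>2 - e / 2\<close> pays back.\<close>

lemma quasidense_imp_NI:
  fixes G :: "('a::real_normed_vector \<times> ('a \<Rightarrow>\<^sub>L real)) set"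
    and y' :: "'a \<Rightarrow>\<^sub>L real" and y'' :: "('a \<Rightarrow>\<^sub>L real) \<Rightarrow>\<^sub>L real"
  assumes "quasidense G" and "0 < e"
  obtains s s' where "(s, s') \<in> G" "(canon s - y'') (s' - y') < e"
proof -
  define n where "n = norm y''"
  obtain u where u: "norm u \<le> n" "n\<^sup>2 - e / 2 \<le> y'' u"
    using nearly_norming[of "e / 2" y''] assms(2) by (auto simp: n_def)
  obtain s s' where s: "(s, s') \<in> G"
    "(norm (s - 0))\<^sup>2 / 2 + (norm (s' - (y' + u)))\<^sup>2 / 2 + (s' - (y' + u)) (s - 0) < e / 2"
    using quasidenseD[OF assms(1), of "e / 2" 0 "y' + u"] assms(2) by auto
  define a where "a = s' - (y' + u)"
  have sa: "(norm s)\<^sup>2 / 2 + (norm a)\<^sup>2 / 2 + a s < e / 2"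
    using s(2) by (simp add: a_def)
  have "u s \<le> norm u * norm s" using norm_blinfun[of u s] by simp
  also have "\<dots> \<le> n * norm s" using u(1) by (rule mult_right_mono) simp
  finally have us: "u s \<le> n * norm s" .
  have ya: "- y'' a \<le> n * norm a" using norm_blinfun[of y'' a] by (simp add: n_def)
  have "s' - y' = a + u" by (simp add: a_def)
  then have "(canon s - y'') (s' - y') = a s + u s - y'' a - y'' u"
    by (simp add: blinfun.bilinear_simps)
  moreover have "2 * (n * norm s) \<le> n\<^sup>2 + (norm s)\<^sup>2" "2 * (n * norm a) \<le> n\<^sup>2 + (norm a)\<^sup>2"
    using sum_squares_bound[of n "norm s"] sum_squares_bound[of n "norm a"] by simp_all
  ultimately have "(canon s - y'') (s' - y') < e"
    using sa us ya u(2) by linarith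
  with s(1) show thesis by (rule that)
qed

text \<open>A graph element \<open>(s, s')\<close> contributes at least
  \<open>y'' y' - (canon s - y'') (s' - y')\<close> to \<open>phi_star\<close>, and the negative
  infimum property makes the subtracted term less than any \<open>e > 0\<close>.\<close>

lemma phi_star_ge_pairing:
  fixes G :: "('a::real_normed_vector \<times> ('a \<Rightarrow>\<^sub>L real)) set"
    and y' :: "'a \<Rightarrow>\<^sub>L real" and y'' :: "('a \<Rightarrow>\<^sub>L real) \<Rightarrow>\<^sub>L real"
  assumes "monotone_graph G" and "quasidense G"
  shows "ereal (y'' y') \<le> phi_star G y' y''"
proof (rule ereal_le_epsilon2)
  fix e :: real assume "0 < e"
  then obtain s s' where s: "(s, s') \<in> G" "(canon s - y'') (s' - y') < e"
    using quasidense_imp_NI[OF assms(2)] by blast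
  have "ereal (y' s + y'' s' - s' s) = ereal (y' s + y'' s') - ereal (s' s)" by simp
  also have "\<dots> \<le> ereal (y' s + y'' s') - phi G s s'"
    using phi_graph_le[OF assms(1) s(1)] by (intro ereal_minus_mono) auto
  also have "\<dots> \<le> phi_star G y' y''"
    unfolding phi_star_def by (intro SUP_upper2[of "(s, s')"]) auto
  finally have "ereal (y' s + y'' s' - s' s) + ereal e \<le> phi_star G y' y'' + ereal e"
    by (intro add_right_mono)
  moreover have "y'' y' \<le> y' s + y'' s' - s' s + e"
    using s(2) by (simp add: blinfun.bilinear_simps)
  ultimately show "ereal (y'' y') \<le> phi_star G y' y'' + ereal e"
    by (metis ereal_less_eq(3) order_trans plus_ereal.simps(1))
qed

text \<open>The bound on \<open>phi\<close> says that
  \<open>(s' - x') (s - x) \<ge> x' x - t > - e\<close> on the whole graph, so in the quasidensity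
  estimate the pairing term cannot offset large squares.\<close>

lemma phi_near_pairing_imp_near_graph:
  fixes G :: "('a::real_normed_vector \<times> ('a \<Rightarrow>\<^sub>L real)) set"
  assumes "quasidense G" and "phi G x x' \<le> ereal t" and "t < x' x + e" and "0 < e"
  obtains s s' where "(s, s') \<in> G" "(norm (s - x))\<^sup>2 + (norm (s' - x'))\<^sup>2 < 4 * e"
proof -
  obtain s s' where s: "(s, s') \<in> G"
    "(norm (s - x))\<^sup>2 / 2 + (norm (s' - x'))\<^sup>2 / 2 + (s' - x') (s - x) < e"
    using quasidenseD[OF assms(1,4)] by blast
  have "x' s + s' x - s' s \<le> t"
    using assms(2) s(1) unfolding phi_le_iff by auto
  then have "- e < (s' - x') (s - x)" using assms(3) by (simp add: blinfun.bilinear_simps)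
  with s show thesis by (intro that) auto
qed

section \<open>The biconjugate and membership in the Fitzpatrick extension\<close>

lemma phi_star_star_le_iff:
  fixes G :: "('a::real_normed_vector \<times> ('a \<Rightarrow>\<^sub>L real)) set"
    and z' :: "'a \<Rightarrow>\<^sub>L real" and z'' :: "('a \<Rightarrow>\<^sub>L real) \<Rightarrow>\<^sub>L real"
  shows "phi_star_star G z'' (canon z') \<le> ereal c \<longleftrightarrow>
    (\<forall>y' y'' a. phi_star G y' y'' \<le> ereal a \<longrightarrow> z'' y' + y'' z' \<le> c + a)"
proof -
  have "ereal b - phi_star G y' y'' \<le> ereal c \<longleftrightarrow>
      (\<forall>a. phi_star G y' y'' \<le> ereal a \<longrightarrow> b \<le> c + a)" for b y' y''
  proof (cases "phi_star G y' y''")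
    case (real r)
    then have "ereal b - phi_star G y' y'' \<le> ereal c \<longleftrightarrow> b \<le> c + r" by auto
    also have "\<dots> \<longleftrightarrow> (\<forall>t. r \<le> t \<longrightarrow> b \<le> c + t)"
      by (auto intro: order_trans)
    finally show ?thesis using real by simp
  next
    case MInf
    have "\<not> (\<forall>a. b \<le> c + a)" by (auto intro!: exI[of _ "b - c - 1"])
    with MInf show ?thesis by simp
  qed auto
  then show ?thesis
    unfolding phi_star_star_def by (auto simp: SUP_le_iff)
qed

lemma fitz_ext_imp_phi_star_star:
  fixes G :: "('a::real_normed_vector \<times> ('a \<Rightarrow>\<^sub>L real)) set"
    and z' :: "'a \<Rightarrow>\<^sub>L real" and z'' :: "('a \<Rightarrow>\<^sub>L real) \<Rightarrow>\<^sub>L real"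
  assumes "G \<noteq> {}" and "monotone_graph G" and "quasidense G" and z: "(z', z'') \<in> fitz_ext G"
  shows "phi_star_star G z'' (canon z') = ereal (z'' z')"
proof (rule antisym)
  have phiz: "phi_star G z' z'' = ereal (z'' z')" using z by (simp add: fitz_ext_def)
  then have "ereal (z'' z') = ereal (z'' z' + canon z' z'') - phi_star G z' z''" by simp
  also have "\<dots> \<le> phi_star_star G z'' (canon z')"
    unfolding phi_star_star_def by (intro SUP_upper2[of "(z', z'')"]) auto
  finally show "ereal (z'' z') \<le> phi_star_star G z'' (canon z')" .
  show "phi_star_star G z'' (canon z') \<le> ereal (z'' z')"
    unfolding phi_star_star_le_iff
  proof (intro allI impI)
    fix y' :: "'a \<Rightarrow>\<^sub>L real" and y'' :: "('a \<Rightarrow>\<^sub>L real) \<Rightarrow>\<^sub>L real" and a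
    assume y: "phi_star G y' y'' \<le> ereal a"
    \<comment> \<open>On the segment from \<open>(z', z'')\<close> towards \<open>(y', y'')\<close>
      the pairing is quadratic in the parameter \<open>l\<close>, with leading coefficient
      \<open>q\<close>. The convex upper bound minus the pairing equals
      \<open>l * (m - l * q)\<close>, and the goal is \<open>0 \<le> m\<close>.\<close>
    define q where "q = (y'' - z'') (y' - z')"
    define m where "m = a + z'' z' - (z'' y' + y'' z')"
    have key: "0 \<le> m - l * q" if l: "0 < l" "l < 1" for l
    proof -
      let ?u' = "z' + l *\<^sub>R (y' - z')" and ?u'' = "z'' + l *\<^sub>R (y'' - z'')"
      \<comment> \<open>This is convexity of \<open>phi_star\<close>: its defining inequalities at
        the two end points are averaged.\<close>
      have "phi_star G ?u' ?u'' \<le> ereal ((1 - l) * z'' z' + l * a)"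
        unfolding phi_star_le_iff[OF assms(1)]
      proof (intro allI impI)
        fix x x' t assume t: "phi G x x' \<le> ereal t"
        have "z' x + z'' x' \<le> z'' z' + t"
          using phiz t phi_star_le_iff[OF assms(1), of z' z'' "z'' z'"] by auto
        moreover have "y' x + y'' x' \<le> a + t"
          using y t phi_star_le_iff[OF assms(1)] by auto
        ultimately have "(1 - l) * (z' x + z'' x') + l * (y' x + y'' x')
            \<le> (1 - l) * (z'' z' + t) + l * (a + t)"
          using l by (intro add_mono[OF mult_left_mono mult_left_mono]) auto
        then show "?u' x + ?u'' x' \<le> (1 - l) * z'' z' + l * a + t"
          by (simp add: blinfun.bilinear_simps algebra_simps)
      qed
      with phi_star_ge_pairing[OF assms(2,3)]
      have "ereal (?u'' ?u') \<le> ereal ((1 - l) * z'' z' + l * a)"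
        by (rule order_trans)
      then have "?u'' ?u' \<le> (1 - l) * z'' z' + l * a"
        by (simp only: ereal_less_eq(3))
      then have "0 \<le> l * (m - l * q)"
        by (simp add: q_def m_def blinfun.bilinear_simps algebra_simps)
      then show ?thesis using l by (simp add: zero_le_mult_iff)
    qed
    have "((\<lambda>l. m - l * q) \<longlongrightarrow> m - 0 * q) (at_right 0)"
      by (intro tendsto_intros)
    moreover have "eventually (\<lambda>l. 0 \<le> m - l * q) (at_right 0)"
      unfolding eventually_at_right_field using key by (intro exI[of _ 1]) simp
    ultimately have "0 \<le> m - 0 * q"
      by (intro tendsto_lowerbound[OF _ _ trivial_limit_at_right_real])
    then show "z'' y' + y'' z' \<le> z'' z' + a" by (simp add: m_def)
  qed
qed

text \<open>If \<open>phi G x x' \<le> t\<close>, every graph element satisfies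
  \<open>x' x - t \<le> (s' - x') (s - x)\<close>. The limit along the sequence for
  \<open>w = x\<close>, \<open>w' = x'\<close> is the inequality needed for \<open>phi_star\<close>
  at \<open>(z', z'')\<close> to be at most the pairing.\<close>

lemma fitz_extI:
  fixes G :: "('a::real_normed_vector \<times> ('a \<Rightarrow>\<^sub>L real)) set"
    and z' :: "'a \<Rightarrow>\<^sub>L real" and z'' :: "('a \<Rightarrow>\<^sub>L real) \<Rightarrow>\<^sub>L real"
  assumes "G \<noteq> {}" and "monotone_graph G" and "quasidense G"
    and approx: "\<And>w w'. \<exists>s. (\<forall>n. s n \<in> G) \<and>
      (\<lambda>n. (snd (s n) - w') (fst (s n) - w)) \<longlonglongrightarrow> (z'' - canon w) (z' - w')"
  shows "(z', z'') \<in> fitz_ext G"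
proof -
  have "phi_star G z' z'' \<le> ereal (z'' z')"
    unfolding phi_star_le_iff[OF assms(1)]
  proof (intro allI impI)
    fix x x' t assume t: "phi G x x' \<le> ereal t"
    obtain s where s: "\<And>n. s n \<in> G"
      and lim: "(\<lambda>n. (snd (s n) - x') (fst (s n) - x)) \<longlonglongrightarrow> (z'' - canon x) (z' - x')"
      using approx by blast
    have "x' x - t \<le> (snd (s n) - x') (fst (s n) - x)" for n
    proof -
      have "x' (fst (s n)) + snd (s n) x - snd (s n) (fst (s n)) \<le> t"
        using t s[of n] unfolding phi_le_iff by (cases "s n") auto
      then show ?thesis by (simp add: blinfun.bilinear_simps)
    qed
    then have "x' x - t \<le> (z'' - canon x) (z' - x')"
      by (intro LIMSEQ_le_const[OF lim]) auto
    then show "z' x + z'' x' \<le> z'' z' + t" by (simp add: blinfun.bilinear_simps)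
  qed
  with phi_star_ge_pairing[OF assms(2,3)] show ?thesis
    by (auto simp: fitz_ext_def intro: antisym)
qed

subsection \<open>Approximation by elements of the graph\<close>

text \<open>The set is an intersection of half-spaces, one for each graph element. It is the
  epigraph of \<open>phi\<close> with heights \<open>k\<close> measured from an affine function; for
  \<open>c = z'' z'\<close> this is the linearisation of the pairing at the target, which thereby
  gets height zero.\<close>

lemma convex_epigraph_phi:
  fixes G :: "('a::real_normed_vector \<times> ('a \<Rightarrow>\<^sub>L real)) set"
    and z' :: "'a \<Rightarrow>\<^sub>L real" and z'' :: "('a \<Rightarrow>\<^sub>L real) \<Rightarrow>\<^sub>L real"
  shows "convex {(x, x', k). phi G x x' \<le> ereal (k + z' x + z'' x' - c)}"
proof -
  define f :: "'a \<Rightarrow> ('a \<Rightarrow>\<^sub>L real) \<Rightarrow> 'a \<times> ('a \<Rightarrow>\<^sub>L real) \<times> real \<Rightarrow> real"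
    where "f = (\<lambda>s s' (x, x', k). blinfun_apply x' s + blinfun_apply s' x - k - z' x - z'' x')"
  have "linear (f s s')" for s s'
    unfolding f_def case_prod_unfold
    by (intro linearI) (simp_all add: blinfun.bilinear_simps algebra_simps)
  then have "convex (f s s' -` {..s' s - c})" for s s'
    by (intro convex_linear_vimage) auto
  then have "convex (\<Inter>(s, s')\<in>G. f s s' -` {..s' s - c})"
    by (intro convex_INT) auto
  also have "(\<Inter>(s, s')\<in>G. f s s' -` {..s' s - c})
      = {(x, x', k). phi G x x' \<le> ereal (k + z' x + z'' x' - c)}"
    by (auto simp: phi_le_iff f_def; force)
  finally show ?thesis .
qed

text \<open>The set \<open>X\<close> stands in for \<open>z''\<close>, which need not come from a
  point of the space. If the sheared epigraph \<open>A\<close> kept distance \<open>r\<close> from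
  \<open>X \<times> {z'} \<times> {0}\<close>, a separating functional would carry over to
  \<open>(z'', z')\<close> and contradict the bound on the biconjugate.\<close>

lemma phi_epigraph_near_bidual_point:
  fixes G :: "('a::real_normed_vector \<times> ('a \<Rightarrow>\<^sub>L real)) set"
    and p z' :: "'a \<Rightarrow>\<^sub>L real" and z'' :: "('a \<Rightarrow>\<^sub>L real) \<Rightarrow>\<^sub>L real"
  assumes ne: "G \<noteq> {}" and mono: "monotone_graph G"
    and bidual: "phi_star_star G z'' (canon z') \<le> ereal (z'' z')"
    and R: "norm z'' < R" and r: "0 < r"
  obtains x x' t x0 where "phi G x x' \<le> ereal t" "t < z' x + z'' x' - z'' z' + r"
    "norm x0 < R" "\<bar>p x0 - z'' p\<bar> < r" "norm (x - x0) < r" "norm (x' - z') < r"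
proof -
  define A where "A = {(x, x', k). phi G x x' \<le> ereal (k + z' x + z'' x' - z'' z')}"
  define X where "X = {x. norm x < R \<and> \<bar>p x - z'' p\<bar> < r}"
  define D where "D = (\<Union>a\<in>A. \<Union>b\<in>X \<times> {z'} \<times> {0}. {a - b})"
  have "X = ball 0 R \<inter> p -` ball (z'' p) r"
    by (auto simp: X_def dist_real_def abs_minus_commute)
  then have "convex X"
    by (auto intro!: convex_Int convex_linear_vimage convex_ball bounded_linear.linear
        blinfun.bounded_linear_right)
  then have "convex D"
    unfolding D_def A_def by (intro convex_differences convex_Times convex_epigraph_phi) auto
  obtain s s' where s: "(s, s') \<in> G" using ne by auto
  define k0 where "k0 = s' s - z' s - z'' s' + z'' z'"
  have k0: "(s, s', k) \<in> A" if "k0 \<le> k" for k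
  proof -
    have "phi G s s' \<le> ereal (s' s)" using mono s by (rule phi_graph_le)
    also have "\<dots> \<le> ereal (k + z' s + z'' s' - z'' z')" using that by (simp add: k0_def)
    finally show ?thesis by (simp add: A_def)
  qed
  obtain xp where "xp \<in> X"
    using Helly_two_functionals[OF R r, of p p] by (auto simp: X_def)
  have "D \<noteq> {}" using k0[OF order_refl] \<open>xp \<in> X\<close> by (force simp: D_def)
  have "\<exists>d\<in>D. norm d < r"
  proof (rule ccontr)
    assume "\<not> ?thesis"
    then have ge: "r \<le> norm d" if "d \<in> D" for d using that by (auto simp: not_less)
    obtain L :: "('a \<times> ('a \<Rightarrow>\<^sub>L real) \<times> real) \<Rightarrow>\<^sub>L real" where L: "\<And>d. d \<in> D \<Longrightarrow> r \<le> L d"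
      by (rule convex_norm_ge_separation[OF \<open>convex D\<close> \<open>D \<noteq> {}\<close> ge]) blast+
    define u' where "u' = Blinfun (\<lambda>x. L (x, 0, 0))"
    define u'' where "u'' = Blinfun (\<lambda>x'. L (0, x', 0))"
    define \<tau> where "\<tau> = L (0, 0, 1)"
    have "bounded_linear (\<lambda>x. L (x, 0, 0))" "bounded_linear (\<lambda>x'. L (0, x', 0))"
      by (rule bounded_linear_compose[OF blinfun.bounded_linear_right] bounded_linear_Pair
          bounded_linear_ident bounded_linear_zero)+
    then have u': "u' x = L (x, 0, 0)" and u'': "u'' x' = L (0, x', 0)" for x x'
      unfolding u'_def u''_def by (simp_all only: bounded_linear_Blinfun_apply)
    have L_split: "L (x, x', k) = u' x + u'' x' + k * \<tau>" for x x' k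
    proof -
      have "L (x, x', k) = L ((x, 0, 0) + (0, x', 0) + k *\<^sub>R (0, 0, 1))" by simp
      also have "\<dots> = u' x + u'' x' + k * \<tau>"
        unfolding u' u'' \<tau>_def by (simp only: blinfun.add_right blinfun.scaleR_right real_scaleR_def)
      finally show ?thesis .
    qed
    define \<zeta> where "\<zeta> = z'' u' + u'' z'"
    \<comment> \<open>Helly's theorem gives a point of \<open>X\<close> at which \<open>u'\<close>
      nearly takes the value \<open>z'' u'\<close>, so the separation from \<open>X\<close> passes
      to \<open>z''\<close>. The tolerance \<open>min e r\<close> serves both the accuracy and
      membership in \<open>X\<close>.\<close>
    have A_ge: "r + \<zeta> \<le> u' x + u'' x' + k * \<tau>" if "(x, x', k) \<in> A" for x x' k
    proof (rule field_le_epsilon)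
      fix e :: real assume "0 < e"
      obtain x0 where x0: "norm x0 < R" "\<bar>p x0 - z'' p\<bar> < min e r" "\<bar>u' x0 - z'' u'\<bar> < min e r"
        using Helly_two_functionals[OF R, of "min e r"] \<open>0 < e\<close> r by auto
      have "(x, x', k) - (x0, z', 0) \<in> D"
        unfolding D_def using that x0 by (intro UN_I) (auto simp: X_def)
      then have "r \<le> L (x - x0, x' - z', k)" using L by force
      then show "r + \<zeta> \<le> u' x + u'' x' + k * \<tau> + e"
        using x0(3) unfolding L_split \<zeta>_def by (simp add: blinfun.bilinear_simps) linarith
    qed
    \<comment> \<open>Over \<open>(s, s')\<close> all heights from \<open>k0\<close> upwards belong
      to \<open>A\<close>, so a negative slope would violate \<open>A_ge\<close> high enough
      up.\<close>
    have "0 \<le> \<tau>"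
    proof (rule ccontr)
      assume "\<not> 0 \<le> \<tau>"
      define M where "M = u' s + u'' s' + k0 * \<tau> - (r + \<zeta>)"
      have "0 \<le> M" using A_ge[OF k0[OF order_refl]] by (simp add: M_def)
      have "(s, s', k0 + (M + 1) / (- \<tau>)) \<in> A"
        using \<open>0 \<le> M\<close> \<open>\<not> 0 \<le> \<tau>\<close> by (intro k0) (simp add: divide_nonneg_neg)
      moreover have "(k0 + (M + 1) / (- \<tau>)) * \<tau> = k0 * \<tau> - (M + 1)"
        using \<open>\<not> 0 \<le> \<tau>\<close> by (simp add: field_simps)
      ultimately show False using A_ge[of s s' "k0 + (M + 1) / (- \<tau>)"] by (simp add: M_def)
    qed
    \<comment> \<open>The separating hyperplane may be vertical (\<open>\<tau> = 0\<close>), so it is tilted by a small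
      multiple \<open>\<kappa>\<close> of the affine minorant of \<open>phi\<close> given by \<open>(s, s')\<close>.\<close>
    define v' where "v' = s' - z'"
    define v'' where "v'' = canon s - z''"
    define c where "c = s' s - z'' z'"
    have small: "r \<le> \<kappa> * (c - z'' v' - v'' z')" if \<kappa>: "0 < \<kappa>" for \<kappa>
    proof -
      define \<sigma> where "\<sigma> = \<tau> + \<kappa>"
      have \<sigma>: "0 < \<sigma>" using \<kappa> \<open>0 \<le> \<tau>\<close> by (simp add: \<sigma>_def)
      \<comment> \<open>Dividing by the positive slope \<open>\<sigma>\<close> normalises the
        coefficient of the height to one, so that the tilted inequality becomes a bound on
        \<open>phi_star\<close> at \<open>(y', y'')\<close>.\<close>
      define y' where "y' = z' + (1 / \<sigma>) *\<^sub>R (\<kappa> *\<^sub>R v' - u')"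
      define y'' where "y'' = z'' + (1 / \<sigma>) *\<^sub>R (\<kappa> *\<^sub>R v'' - u'')"
      have "phi_star G y' y'' \<le> ereal (z'' z' + (\<kappa> * c - (r + \<zeta>)) / \<sigma>)"
        unfolding phi_star_le_iff[OF ne]
      proof (intro allI impI)
        fix x x' t assume t: "phi G x x' \<le> ereal t"
        define k where "k = t - z' x - z'' x' + z'' z'"
        have "(x, x', k) \<in> A" using t by (simp add: A_def k_def)
        then have 1: "r + \<zeta> \<le> u' x + u'' x' + k * \<tau>" by (rule A_ge)
        have "x' s + s' x - s' s \<le> t" using t s by (auto simp: phi_le_iff)
        then have "v' x + v'' x' - c \<le> k"
          by (simp add: v'_def v''_def c_def k_def blinfun.bilinear_simps)
        then have "\<kappa> * (v' x + v'' x' - c) \<le> \<kappa> * k" using \<kappa> by (intro mult_left_mono) auto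
        with 1 have "(\<kappa> * v' x - u' x) + (\<kappa> * v'' x' - u'' x') - (\<kappa> * c - (r + \<zeta>)) \<le> \<sigma> * k"
          by (simp add: \<sigma>_def algebra_simps)
        then have "((\<kappa> * v' x - u' x) + (\<kappa> * v'' x' - u'' x') - (\<kappa> * c - (r + \<zeta>))) / \<sigma> \<le> k"
          using \<sigma> by (simp add: pos_divide_le_eq mult.commute)
        then show "y' x + y'' x' \<le> z'' z' + (\<kappa> * c - (r + \<zeta>)) / \<sigma> + t"
          by (simp add: y'_def y''_def k_def blinfun.bilinear_simps add_divide_distrib diff_divide_distrib)
      qed
      with bidual have "z'' y' + y'' z' \<le> z'' z' + (z'' z' + (\<kappa> * c - (r + \<zeta>)) / \<sigma>)"
        unfolding phi_star_star_le_iff by blast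
      then have "(\<kappa> * (z'' v' + v'' z') - \<zeta>) / \<sigma> \<le> (\<kappa> * c - (r + \<zeta>)) / \<sigma>"
        by (simp add: y'_def y''_def \<zeta>_def blinfun.bilinear_simps add_divide_distrib
            diff_divide_distrib distrib_left)
      then show ?thesis using \<sigma> by (simp add: divide_le_cancel algebra_simps)
    qed
    \<comment> \<open>\<open>K\<close> is a positive bound for the factor of
      \<open>\<kappa>\<close>; the choice \<open>\<kappa> = r / (2 * K)\<close> turns
      \<open>small\<close> into \<open>r \<le> r / 2\<close>.\<close>
    define K where "K = \<bar>c - z'' v' - v'' z'\<bar> + 1"
    have K: "0 < K" "c - z'' v' - v'' z' \<le> K" by (simp_all add: K_def)
    have "r \<le> r / (2 * K) * (c - z'' v' - v'' z')"
      using r K by (intro small) simp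
    also have "\<dots> \<le> r / (2 * K) * K"
      using r K by (intro mult_left_mono) simp_all
    also have "\<dots> = r / 2" using K(1) by simp
    finally show False using r by simp
  qed
  then obtain x x' k x0 where A: "(x, x', k) \<in> A" and X: "x0 \<in> X"
    and n: "norm ((x, x', k) - (x0, z', 0)) < r"
    by (auto simp: D_def)
  then have "norm (x - x0, x' - z', k) < r" by simp
  moreover have "norm (x' - z', k) \<le> norm (x - x0, x' - z', k)"
    by (rule norm_snd_le)
  ultimately have "norm (x - x0) < r" "norm (x' - z') < r" "\<bar>k\<bar> < r"
    using norm_fst_le[of "x - x0" "(x' - z', k)"] norm_fst_le[of "x' - z'" k]
      norm_snd_le[of k "x' - z'"] by simp_all
  then show thesis
    using A X that[of x x' "k + z' x + z'' x' - z'' z'" x0] by (auto simp: A_def X_def)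
qed

text \<open>The error bounds are explicit in \<open>r\<close> so that they can be sent to zero. Here
  \<open>\<delta>\<^sup>2\<close> is four times \<open>r * (2 * R + r)\<close>, the allowed excess
  of \<open>phi\<close> over the pairing at the nearby point.\<close>

lemma graph_near_bidual_point:
  fixes G :: "('a::real_normed_vector \<times> ('a \<Rightarrow>\<^sub>L real)) set"
    and z' w' :: "'a \<Rightarrow>\<^sub>L real" and z'' :: "('a \<Rightarrow>\<^sub>L real) \<Rightarrow>\<^sub>L real"
  assumes "G \<noteq> {}" and "monotone_graph G" and "quasidense G"
    and "phi_star_star G z'' (canon z') \<le> ereal (z'' z')" and r: "0 < r"
  defines "R \<equiv> norm z'' + 1" and "p \<equiv> z' - w'"
  defines "\<delta> \<equiv> 2 * sqrt (r * (2 * R + r))"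
  obtains s s' where "(s, s') \<in> G" "norm (s' - z') \<le> \<delta> + r"
    "\<bar>(s' - w') s - z'' p\<bar> \<le> (\<delta> + r) * (R + r + \<delta>) + norm p * (\<delta> + r) + r"
proof -
  have "norm z'' < R" by (simp add: R_def)
  then obtain x x' t x0 where t: "phi G x x' \<le> ereal t" "t < z' x + z'' x' - z'' z' + r"
    and x0: "norm x0 < R" "\<bar>p x0 - z'' p\<bar> < r" and x: "norm (x - x0) < r" "norm (x' - z') < r"
    using phi_epigraph_near_bidual_point[OF assms(1,2,4) _ r] by blast
  have nx: "norm x \<le> R + r" using norm_triangle_sub[of x x0] x(1) x0(1) by linarith
  have "\<bar>(x' - z') x\<bar> \<le> norm (x' - z') * norm x" using norm_blinfun[of "x' - z'" x] by simp
  also have "\<dots> \<le> r * (R + r)" using nx x(2) r by (intro mult_mono) auto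
  finally have 1: "\<bar>(x' - z') x\<bar> \<le> r * (R + r)" .
  have "\<bar>z'' (x' - z')\<bar> \<le> norm z'' * norm (x' - z')" using norm_blinfun[of z'' "x' - z'"] by simp
  also have "\<dots> \<le> norm z'' * r" using x(2) by (intro mult_left_mono) auto
  finally have 2: "\<bar>z'' (x' - z')\<bar> \<le> r * norm z''" by (simp add: mult.commute)
  have pos: "0 < r * (2 * R + r)" using r by (simp add: R_def add_nonneg_pos)
  \<comment> \<open>Replacing the linearised pairing by \<open>x' x\<close> costs at most
    \<open>r * (R + r) + r * norm z''\<close>; the summand one in \<open>R\<close> absorbs the
    remaining \<open>r\<close>.\<close>
  have "t < x' x + r * (2 * R + r)"
    using t(2) 1 2 by (simp add: blinfun.bilinear_simps R_def algebra_simps)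
  then obtain s s' where s: "(s, s') \<in> G"
    "(norm (s - x))\<^sup>2 + (norm (s' - x'))\<^sup>2 < 4 * (r * (2 * R + r))"
    using phi_near_pairing_imp_near_graph[OF assms(3) t(1)] pos by blast
  have \<delta>2: "4 * (r * (2 * R + r)) = \<delta>\<^sup>2" and "0 \<le> \<delta>"
    using pos by (simp_all add: \<delta>_def power_mult_distrib)
  have sx: "norm (s - x) \<le> \<delta>"
    using s(2) zero_le_power2[of "norm (s' - x')"] unfolding \<delta>2
    by (intro power2_le_imp_le[OF _ \<open>0 \<le> \<delta>\<close>]) linarith
  have sx': "norm (s' - x') \<le> \<delta>"
    using s(2) zero_le_power2[of "norm (s - x)"] unfolding \<delta>2
    by (intro power2_le_imp_le[OF _ \<open>0 \<le> \<delta>\<close>]) linarith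
  have sz: "norm (s' - z') \<le> \<delta> + r"
    using norm_triangle_ineq[of "s' - x'" "x' - z'"] sx' x(2) by simp
  have ns: "norm s \<le> R + r + \<delta>"
    using norm_triangle_sub[of s x] sx nx by linarith
  have "\<bar>(s' - z') s\<bar> \<le> norm (s' - z') * norm s" using norm_blinfun[of "s' - z'" s] by simp
  also have "\<dots> \<le> (\<delta> + r) * (R + r + \<delta>)" using sz ns \<open>0 \<le> \<delta>\<close> r by (intro mult_mono) auto
  finally have 3: "\<bar>(s' - z') s\<bar> \<le> (\<delta> + r) * (R + r + \<delta>)" .
  have "norm (s - x0) \<le> \<delta> + r"
    using norm_triangle_ineq[of "s - x" "x - x0"] sx x(1) by simp
  then have "norm p * norm (s - x0) \<le> norm p * (\<delta> + r)" by (intro mult_left_mono) auto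
  then have 4: "\<bar>p (s - x0)\<bar> \<le> norm p * (\<delta> + r)"
    using norm_blinfun[of p "s - x0"] by simp
  \<comment> \<open>The error splits into the distance of \<open>s'\<close> from \<open>z'\<close>,
    that of \<open>s\<close> from \<open>x0\<close>, and the defect of \<open>x0\<close> as a
    substitute for \<open>z''\<close> on \<open>p\<close>.\<close>
  have "(s' - w') s - z'' p = (s' - z') s + p (s - x0) + (p x0 - z'' p)"
    by (simp add: p_def blinfun.bilinear_simps)
  then have "\<bar>(s' - w') s - z'' p\<bar> \<le> (\<delta> + r) * (R + r + \<delta>) + norm p * (\<delta> + r) + r"
    using 3 4 x0(2) by linarith
  with s(1) sz show thesis by (rule that)
qed

text \<open>One graph element is chosen for each \<open>r = 1 / (n + 1)\<close>; the error bounds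
  tend to zero with \<open>r\<close>.\<close>

lemma phi_star_star_imp_approx:
  fixes G :: "('a::real_normed_vector \<times> ('a \<Rightarrow>\<^sub>L real)) set"
    and z' :: "'a \<Rightarrow>\<^sub>L real" and z'' :: "('a \<Rightarrow>\<^sub>L real) \<Rightarrow>\<^sub>L real"
  assumes "G \<noteq> {}" and "monotone_graph G" and "quasidense G"
    and "phi_star_star G z'' (canon z') \<le> ereal (z'' z')"
  shows "\<exists>s. (\<forall>n. s n \<in> G) \<and>
    (\<lambda>n. (snd (s n) - w') (fst (s n))) \<longlonglongrightarrow> z'' (z' - w') \<and>
    (\<lambda>n. norm (snd (s n) - z')) \<longlonglongrightarrow> 0"
proof -
  define R where "R = norm z'' + 1"
  define p where "p = z' - w'"
  define \<delta> where "\<delta> = (\<lambda>r. 2 * sqrt (r * (2 * R + r)))"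
  define B where "B = (\<lambda>r. (\<delta> r + r) * (R + r + \<delta> r) + norm p * (\<delta> r + r) + r)"
  define r where "r = (\<lambda>n. inverse (real (Suc n)))"
  have "\<exists>a. a \<in> G \<and> norm (snd a - z') \<le> \<delta> (r n) + r n \<and>
      \<bar>(snd a - w') (fst a) - z'' p\<bar> \<le> B (r n)" for n
    using graph_near_bidual_point[OF assms, of "r n" w']
    unfolding B_def \<delta>_def p_def R_def r_def by (metis fst_conv snd_conv inverse_positive_iff_positive of_nat_0_less_iff zero_less_Suc)
  then obtain s where s: "\<And>n. s n \<in> G" "\<And>n. norm (snd (s n) - z') \<le> \<delta> (r n) + r n"
      "\<And>n. \<bar>(snd (s n) - w') (fst (s n)) - z'' p\<bar> \<le> B (r n)"
    by metis
  have r0: "r \<longlonglongrightarrow> 0" unfolding r_def by (rule LIMSEQ_inverse_real_of_nat)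
  have \<delta>0: "(\<lambda>n. \<delta> (r n)) \<longlonglongrightarrow> 0"
    unfolding \<delta>_def by (rule tendsto_eq_intros r0 refl | simp)+
  have B0: "(\<lambda>n. B (r n)) \<longlonglongrightarrow> 0"
    unfolding B_def by (rule tendsto_eq_intros r0 \<delta>0 refl | simp)+
  have N0: "(\<lambda>n. \<delta> (r n) + r n) \<longlonglongrightarrow> 0"
    by (rule tendsto_eq_intros r0 \<delta>0 refl | simp)+
  have "(\<lambda>n. (snd (s n) - w') (fst (s n)) - z'' p) \<longlonglongrightarrow> 0"
    using s(3) by (intro Lim_null_comparison[OF _ B0]) auto
  then have "(\<lambda>n. (snd (s n) - w') (fst (s n))) \<longlonglongrightarrow> z'' (z' - w')"
    unfolding p_def by (rule LIM_zero_cancel)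
  moreover have "(\<lambda>n. norm (snd (s n) - z')) \<longlonglongrightarrow> 0"
    using s(2) by (intro Lim_null_comparison[OF _ N0]) auto
  ultimately show ?thesis using s(1) by blast
qed

section \<open>The four conditions as a cycle of implications (a), (b), (c), (d), (a)\<close>

theorem theorem7p5:
  fixes G :: "('a::banach \<times> ('a \<Rightarrow>\<^sub>L real)) set"
    and z' :: "'a \<Rightarrow>\<^sub>L real" and z'' :: "('a \<Rightarrow>\<^sub>L real) \<Rightarrow>\<^sub>L real"
  assumes nonzero: "\<exists>x::'a. x \<noteq> 0"
    and nonempty: "G \<noteq> {}"
    and closedG: "closed G"
    and mono: "monotone_graph G"
    and qd: "quasidense G"
  shows "((z', z'') \<in> fitz_ext G
          \<longleftrightarrow> phi_star_star G z'' (canon z') = ereal (blinfun_apply z'' z'))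
       \<and> ((z', z'') \<in> fitz_ext G
          \<longleftrightarrow> (\<forall>w'. \<exists>s :: nat \<Rightarrow> 'a \<times> ('a \<Rightarrow>\<^sub>L real).
                 (\<forall>n. s n \<in> G)
               \<and> ((\<lambda>n. blinfun_apply (snd (s n) - w') (fst (s n)))
                    \<longlonglongrightarrow> blinfun_apply z'' (z' - w'))
               \<and> ((\<lambda>n. norm (snd (s n) - z')) \<longlonglongrightarrow> 0)))
       \<and> ((z', z'') \<in> fitz_ext G
          \<longleftrightarrow> (\<forall>w w'. \<exists>s :: nat \<Rightarrow> 'a \<times> ('a \<Rightarrow>\<^sub>L real).
                 (\<forall>n. s n \<in> G)
               \<and> ((\<lambda>n. blinfun_apply (snd (s n) - w') (fst (s n) - w))
                    \<longlonglongrightarrow> blinfun_apply (z'' - canon w) (z' - w'))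
               \<and> ((\<lambda>n. norm (snd (s n) - z')) \<longlonglongrightarrow> 0)))"
    (is "(?a \<longleftrightarrow> ?b) \<and> (?a \<longleftrightarrow> ?c) \<and> (?a \<longleftrightarrow> ?d)")
proof -
  have ab: ?b if ?a
    using nonempty mono qd that by (rule fitz_ext_imp_phi_star_star)
  have bc: ?c if ?b
    using phi_star_star_imp_approx[OF nonempty mono qd] that by simp
  have cd: ?d if ?c
  proof (intro allI)
    fix w w'
    obtain s where s: "\<forall>n. s n \<in> G"
      and lim: "(\<lambda>n. (snd (s n) - w') (fst (s n))) \<longlonglongrightarrow> z'' (z' - w')"
      and n0: "(\<lambda>n. norm (snd (s n) - z')) \<longlonglongrightarrow> 0"
      using \<open>?c\<close> by blast
    from n0 have "(\<lambda>n. snd (s n)) \<longlonglongrightarrow> z'"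
      by (rule LIM_zero_cancel[OF tendsto_norm_zero_cancel])
    \<comment> \<open>Norm convergence of the second components makes the extra term, their value at
      the fixed \<open>w\<close>, converge.\<close>
    then have "(\<lambda>n. (snd (s n) - w') (fst (s n)) - (snd (s n) - w') w)
        \<longlonglongrightarrow> z'' (z' - w') - (z' - w') w"
      by (intro tendsto_intros lim)
    also have "z'' (z' - w') - (z' - w') w = (z'' - canon w) (z' - w')"
      by (simp add: blinfun.diff_left)
    finally have "(\<lambda>n. (snd (s n) - w') (fst (s n) - w)) \<longlonglongrightarrow> (z'' - canon w) (z' - w')"
      by (simp only: blinfun.diff_right)
    with s n0 show "\<exists>s. (\<forall>n. s n \<in> G)
        \<and> ((\<lambda>n. (snd (s n) - w') (fst (s n) - w)) \<longlonglongrightarrow> (z'' - canon w) (z' - w'))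
        \<and> ((\<lambda>n. norm (snd (s n) - z')) \<longlonglongrightarrow> 0)"
      by blast
  qed
  have da: ?a if ?d
    using fitz_extI[OF nonempty mono qd] that by blast
  from ab bc cd da show ?thesis by blast
qed

end
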